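(* Let $M=(E,\mathbf I)$ be a finitary matroid of finite rank, and let $\mathbf F=(\mathbf F_i)$ and $\mathbf G=(\mathbf G_j)$ be filtrations of $M$. Then the following are equivalent. (1) The pair $(\mathbf F,\mathbf G)$ is modular. (2) There exists a basis of $M$ that has minimal weight with respect to both $\chi_{\mathbf F}$ and $\chi_{\mathbf G}$. (3) There exists a basis $B$ of $M$ such that, for all $i,j$, the set $B\cap(\mathbf F_i\cap\mathbf G_j)$ is a basis of (the restriction of $M$ to) $\mathbf F_i\cap\mathbf G_j$.
   Context: A (finitary, finite-rank) matroid $M$ is a pair $(E,\mathbf I)$ with $E$ a possibly infinite set and $\mathbf I\subseteq 2^E$ a family of (independent) subsets satisfying the usual matroid axioms; all bases (maximal independent sets) are finite and of the same size. For $S\subseteq E$, $\mathrm{rk}(S)$ is the common size of the maximal independent subsets of $S$, and a basis of $S$ is a basis of the restriction $M|S$, i.e. a maximal independent subset of $S$. The closure of $S$ consists of $S$ together with all $e\in E$ such that $\{e\}=C-S$ for some circuit $C$; a flat is a subset equal to its closure. A filtration $\mathbf F$ of $M$ is a nested sequence of flats $\emptyset=\mathbf F_0\subseteq\cdots\subseteq\mathbf F_L=E$. Its characteristic function is the map $\chi_{\mathbf F}:E\to\mathbb Z_{\ge0}$ with $\mathbf F_k=\chi_{\mathbf F}^{-1}\{0,\dots,k\}$ for all $k$, i.e. $\chi_{\mathbf F}(e)=\min\{k: e\in\mathbf F_k\}$. The pair $(\mathbf F,\mathbf G)$ is modular if $$\mathrm{rk}(\mathbf F_i\cap\mathbf G_j)+\mathrm{rk}(\mathbf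 F_i\cup\mathbf G_j)=\mathrm{rk}(\mathbf F_i)+\mathrm{rk}(\mathbf G_j)$$ for all $i$ and $j$. For $f:E\to\mathbb Z$, a basis $B$ has minimal weight with respect to $f$ if it minimizes $f(B)=\sum_{b\in B}f(b)$ among all bases of $M$. *)

theory Defs
  imports Main
begin

text \<open>
  A matroid is given by its ground set \<open>E\<close> and its family \<open>I\<close> of independent sets.
  Restriction of \<open>(E, I)\<close> to \<open>S\<close> is \<open>(S, restriction I S)\<close>; hence a basis of a set \<open>S\<close> is an element
  of \<open>bases (restriction I S)\<close>.
\<close>

definition bases :: "'a set set \<Rightarrow> 'a set set" where
  "bases I = {B \<in> I. \<forall>X\<in>I. B \<subseteq> X \<longrightarrow> X = B}"

definition restriction :: "'a set set \<Rightarrow> 'a set \<Rightarrow> 'a set set" where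
  "restriction I S = {X \<in> I. X \<subseteq> S}"

locale finitary_matroid =
  fixes E :: "'a set" and I :: "'a set set"
  assumes indep_subset_ground: "X \<in> I \<Longrightarrow> X \<subseteq> E"
    and empty_indep: "{} \<in> I"
    and hereditary: "X \<in> I \<Longrightarrow> Y \<subseteq> X \<Longrightarrow> Y \<in> I"
    and augmentation: "X \<in> I \<Longrightarrow> Y \<in> I \<Longrightarrow> finite X \<Longrightarrow> finite Y \<Longrightarrow> card X < card Y
      \<Longrightarrow> \<exists>y\<in>Y - X. insert y X \<in> I"
    and finitary: "X \<subseteq> E \<Longrightarrow> (\<And>Y. Y \<subseteq> X \<Longrightarrow> finite Y \<Longrightarrow> Y \<in> I) \<Longrightarrow> X \<in> I"

text \<open>
  One finite basis is enough: \<open>finite_indep\<close> and \<open>card_bases_restriction\<close> below derive that all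
  bases, of the matroid and of its restrictions, are finite and of the same size.
\<close>

locale finite_rank_matroid = finitary_matroid +
  assumes finite_basis: "\<exists>B\<in>bases I. finite B"

definition rk :: "'a set set \<Rightarrow> 'a set \<Rightarrow> nat" where
  "rk I S = (THE n. \<exists>B\<in>bases (restriction I S). n = card B)"

definition circuits :: "'a set \<Rightarrow> 'a set set \<Rightarrow> 'a set set" where
  "circuits E I = {C. C \<subseteq> E \<and> C \<notin> I \<and> (\<forall>D. D \<subset> C \<longrightarrow> D \<in> I)}"

definition matroid_closure :: "'a set \<Rightarrow> 'a set set \<Rightarrow> 'a set \<Rightarrow> 'a set" where
  "matroid_closure E I S = S \<union> {e \<in> E. \<exists>C\<in>circuits E I. {e} = C - S}"

definition flat :: "'a set \<Rightarrow> 'a set set \<Rightarrow> 'a set \<Rightarrow> bool" where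
  "flat E I S \<longleftrightarrow> S \<subseteq> E \<and> matroid_closure E I S = S"

text \<open>A filtration of length \<open>L\<close>; only the values \<open>F 0, \<dots>, F L\<close> are meaningful.\<close>

definition filtration :: "'a set \<Rightarrow> 'a set set \<Rightarrow> nat \<Rightarrow> (nat \<Rightarrow> 'a set) \<Rightarrow> bool" where
  "filtration E I L F \<longleftrightarrow>
     F 0 = {} \<and> F L = E \<and> (\<forall>k\<le>L. flat E I (F k)) \<and> (\<forall>k<L. F k \<subseteq> F (Suc k))"

text \<open>On \<open>E = F L\<close> the minimum exists and is at most \<open>L\<close>; values outside \<open>E\<close> are irrelevant.\<close>

definition char_fun :: "(nat \<Rightarrow> 'a set) \<Rightarrow> 'a \<Rightarrow> nat" where
  "char_fun F e = (LEAST k. e \<in> F k)"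

definition modular_pair ::
  "'a set set \<Rightarrow> nat \<Rightarrow> (nat \<Rightarrow> 'a set) \<Rightarrow> nat \<Rightarrow> (nat \<Rightarrow> 'a set) \<Rightarrow> bool" where
  "modular_pair I L F K G \<longleftrightarrow>
     (\<forall>i\<le>L. \<forall>j\<le>K. rk I (F i \<inter> G j) + rk I (F i \<union> G j) = rk I (F i) + rk I (G j))"

definition minimal_weight_basis :: "'a set set \<Rightarrow> ('a \<Rightarrow> int) \<Rightarrow> 'a set \<Rightarrow> bool" where
  "minimal_weight_basis I f B \<longleftrightarrow>
     B \<in> bases I \<and> (\<forall>B'\<in>bases I. (\<Sum>b\<in>B. f b) \<le> (\<Sum>b\<in>B'. f b))"

context finite_rank_matroid
begin

lemma indep_finite_card_bounded: "\<exists>n. \<forall>X\<in>I. finite X \<and> card X \<le> n"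
proof -
  obtain B where B: "B \<in> bases I" "finite B"
    using finite_basis by blast
  have fin: "card X \<le> card B" if X: "X \<in> I" "finite X" for X
  proof (rule ccontr)
    assume "\<not> card X \<le> card B"
    moreover have "B \<in> I"
      using B(1) by (simp add: bases_def)
    ultimately obtain y where "y \<in> X - B" "insert y B \<in> I"
      using augmentation[of B X] B(2) X by auto
    moreover have "insert y B = B"
      using B(1) \<open>insert y B \<in> I\<close> by (simp add: bases_def subset_insertI)
    ultimately show False by blast
  qed
  have "finite X" if X: "X \<in> I" for X
  proof (rule ccontr)
    assume "infinite X"
    then obtain Y where "Y \<subseteq> X" "finite Y" "card Y = Suc (card B)"
      using infinite_arbitrarily_large by blast
    then show False
      using fin[of Y] hereditary[OF X, of Y] by simp
  qed
  with fin show ?thesis by blast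
qed

lemma finite_indep: "X \<in> I \<Longrightarrow> finite X"
  using indep_finite_card_bounded by blast

lemma bases_restriction_nonempty: "bases (restriction I S) \<noteq> {}"
proof -
  obtain n where n: "\<And>X. X \<in> I \<Longrightarrow> card X \<le> n"
    using indep_finite_card_bounded by blast
  have "{} \<in> restriction I S"
    using empty_indep by (simp add: restriction_def)
  then obtain B where B: "B \<in> restriction I S"
    and max: "\<And>X. X \<in> restriction I S \<Longrightarrow> card X \<le> card B"
    using ex_has_greatest_nat[of "\<lambda>X. X \<in> restriction I S" "{}" card "Suc n"] n
    by (auto simp: restriction_def less_Suc_eq_le)
  have "X = B" if "X \<in> restriction I S" "B \<subseteq> X" for X
  proof -
    have "finite X"
      using that(1) finite_indep by (simp add: restriction_def)
    then show ?thesis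
      using card_seteq[of X B] that(2) max[OF that(1)] by simp
  qed
  with B have "B \<in> bases (restriction I S)"
    by (simp add: bases_def)
  then show ?thesis by blast
qed

lemma card_bases_restriction:
  assumes "B \<in> bases (restriction I S)" "B' \<in> bases (restriction I S)"
  shows "card B = card B'"
proof -
  have le: "card Y \<le> card X"
    if X: "X \<in> bases (restriction I S)" and Y: "Y \<in> bases (restriction I S)" for X Y
  proof (rule ccontr)
    assume "\<not> card Y \<le> card X"
    moreover have "X \<in> I" "Y \<in> I" "X \<subseteq> S" "Y \<subseteq> S"
      using X Y by (auto simp: bases_def restriction_def)
    ultimately obtain y where "y \<in> Y - X" "insert y X \<in> I"
      using augmentation[of X Y] finite_indep by auto
    moreover have "insert y X = X"
    proof -
      have "insert y X \<in> restriction I S"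
        using calculation \<open>X \<subseteq> S\<close> \<open>Y \<subseteq> S\<close> by (auto simp: restriction_def)
      with X show ?thesis
        by (simp add: bases_def subset_insertI)
    qed
    ultimately show False by blast
  qed
  show ?thesis
    using le assms by (simp add: le_antisym)
qed

lemma rk_eq_card: "B \<in> bases (restriction I S) \<Longrightarrow> rk I S = card B"
  unfolding rk_def by (rule the_equality) (auto intro: card_bases_restriction)

lemma restriction_ground: "restriction I E = I"
  using indep_subset_ground by (auto simp: restriction_def)

end

lemma filtration_eq_char_fun:
  assumes F: "filtration E I L F" and k: "k \<le> L"
  shows "F k = {e \<in> E. char_fun F e \<le> k}"
proof -
  have mono: "F i \<subseteq> F j" if "i \<le> j" "j \<le> L" for i j
    using that
  proof (induction j rule: dec_induct)
    case (step n)
    then have "F i \<subseteq> F n" "F n \<subseteq> F (Suc n)"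
      using F by (simp_all add: filtration_def)
    then show ?case by (rule subset_trans)
  qed simp
  have "e \<in> F (char_fun F e)" if "e \<in> E" for e
    using that F LeastI[of "\<lambda>k. e \<in> F k" L] by (simp add: filtration_def char_fun_def)
  moreover have "char_fun F e \<le> k" if "e \<in> F k" for e
    using that unfolding char_fun_def by (rule Least_le)
  moreover have "F k \<subseteq> E"
    using F k by (simp add: filtration_def flat_def)
  ultimately show ?thesis
    using mono[OF _ k] by blast
qed

end

theory Submission
  imports Defs
begin

text \<open>
  The \<open>\<chi>\<^sub>F\<close>-weight of a basis \<open>B\<close> equals the sum over \<open>k < L\<close> of \<open>card B - card (B \<inter> F k)\<close>, so \<open>B\<close> has
  minimal weight iff it contains a basis of every \<open>F k\<close>. If \<open>B\<close> does so for both filtrations,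
  counting \<open>B\<close> in intersections and unions gives the reverse of the submodular inequality.

  Conversely, a basis adapted to \<open>F\<close> and \<open>G\<close> is built along \<open>F\<close>: a basis of \<open>F i\<close> is extended
  successively through the sets \<open>F i \<union> (F (Suc i) \<inter> G j)\<close>, whose ranks are determined by the
  modularity of \<open>F i\<close> and \<open>G j\<close>.
\<close>

context finite_rank_matroid
begin

section \<open>Bases of restrictions and the rank function\<close>

lemma basis_extension:
  assumes "X \<in> I" "X \<subseteq> S"
  obtains Y where "Y \<in> bases (restriction I S)" "X \<subseteq> Y"
proof -
  obtain n where n: "\<And>Y. Y \<in> I \<Longrightarrow> card Y \<le> n"
    using indep_finite_card_bounded by blast
  let ?P = "\<lambda>Y. Y \<in> I \<and> Y \<subseteq> S \<and> X \<subseteq> Y"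
  have "?P X" "\<forall>Y. ?P Y \<longrightarrow> card Y < Suc n"
    using assms n by (auto simp: less_Suc_eq_le)
  then obtain Y where Y: "?P Y" and max: "\<And>Z. ?P Z \<Longrightarrow> card Z \<le> card Y"
    using ex_has_greatest_nat[of ?P X card "Suc n"] by (metis less_imp_le)
  have "Z = Y" if "Z \<in> I" "Z \<subseteq> S" "Y \<subseteq> Z" for Z
  proof -
    have "card Z \<le> card Y"
      using that Y by (intro max) auto
    then show ?thesis
      using card_seteq[of Z Y] that finite_indep by blast
  qed
  with Y show thesis
    by (intro that[of Y]) (auto simp: bases_def restriction_def)
qed

lemma card_le_rk:
  assumes "X \<in> I" "X \<subseteq> S"
  shows "card X \<le> rk I S"
proof -
  obtain Y where "Y \<in> bases (restriction I S)" "X \<subseteq> Y"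
    using basis_extension[OF assms] .
  moreover from this have "finite Y"
    by (auto simp: bases_def restriction_def finite_indep)
  ultimately show ?thesis
    by (metis card_mono rk_eq_card)
qed

lemma basis_restriction_iff_card:
  "X \<in> bases (restriction I S) \<longleftrightarrow> X \<in> I \<and> X \<subseteq> S \<and> card X = rk I S"
proof
  assume "X \<in> bases (restriction I S)"
  then show "X \<in> I \<and> X \<subseteq> S \<and> card X = rk I S"
    using rk_eq_card by (auto simp: bases_def restriction_def)
next
  assume X: "X \<in> I \<and> X \<subseteq> S \<and> card X = rk I S"
  then obtain Y where Y: "Y \<in> bases (restriction I S)" "X \<subseteq> Y"
    using basis_extension by blast
  then have "finite Y" "card X = card Y"
    using X rk_eq_card by (auto simp: bases_def restriction_def finite_indep)
  then have "X = Y"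
    using Y(2) by (simp add: card_subset_eq)
  with Y show "X \<in> bases (restriction I S)" by simp
qed

lemma bases_iff_card: "B \<in> bases I \<longleftrightarrow> B \<in> I \<and> card B = rk I E"
  using basis_restriction_iff_card[of B E] indep_subset_ground
  by (auto simp: restriction_ground)

lemma card_Int_le_rk: "X \<in> I \<Longrightarrow> card (X \<inter> S) \<le> rk I S"
  using hereditary by (intro card_le_rk) auto

lemma Int_basis_iff_card:
  "X \<in> I \<Longrightarrow> X \<inter> S \<in> bases (restriction I S) \<longleftrightarrow> card (X \<inter> S) = rk I S"
  using hereditary[of X "X \<inter> S"] by (auto simp: basis_restriction_iff_card)

text \<open>The trace \<open>Y \<inter> S\<close> is independent, so it has at most
  \<open>rk I S\<close> elements, and \<open>X\<close> already supplies that many. Thus enlarging a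
  basis of \<open>S\<close> adds only elements outside \<open>S\<close>.\<close>

lemma Int_eq_of_basis_subset:
  assumes "X \<in> bases (restriction I S)" "X \<subseteq> Y" "Y \<in> I"
  shows "Y \<inter> S = X"
proof -
  have "X \<subseteq> Y \<inter> S" "finite (Y \<inter> S)" "card (Y \<inter> S) \<le> card X"
    using assms card_Int_le_rk[of Y S] finite_indep
    by (auto simp: basis_restriction_iff_card)
  then show ?thesis
    using card_seteq by blast
qed

lemma card_Int_add_card_Int:
  assumes "X \<in> I"
  shows "card (X \<inter> S) + card (X \<inter> T) = card (X \<inter> (S \<union> T)) + card (X \<inter> (S \<inter> T))"
proof -
  have "X \<inter> (S \<union> T) = (X \<inter> S) \<union> (X \<inter> T)" "X \<inter> (S \<inter> T) = (X \<inter> S) \<inter> (X \<inter> T)"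
    by auto
  then show ?thesis
    using card_Un_Int[of "X \<inter> S" "X \<inter> T"] finite_indep[OF assms] by simp
qed

text \<open>A basis \<open>Z\<close> of \<open>S \<inter> T\<close> extends to a basis
  \<open>Y\<close> of \<open>S \<union> T\<close>, and \<open>Y\<close> meets
  \<open>S \<inter> T\<close> in \<open>Z\<close> alone. The left side therefore counts
  \<open>Y\<close> in \<open>S\<close> plus \<open>Y\<close> in \<open>T\<close>, and each of these
  counts is bounded by the corresponding rank.\<close>

lemma rk_submodular: "rk I (S \<inter> T) + rk I (S \<union> T) \<le> rk I S + rk I T"
proof -
  obtain Z where Z: "Z \<in> bases (restriction I (S \<inter> T))"
    using bases_restriction_nonempty by blast
  then have "Z \<in> I" "Z \<subseteq> S \<union> T"
    by (auto simp: basis_restriction_iff_card)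
  then obtain Y where Y: "Y \<in> bases (restriction I (S \<union> T))" "Z \<subseteq> Y"
    using basis_extension by blast
  then have YI: "Y \<in> I" and "Y \<inter> (S \<union> T) = Y"
    by (auto simp: basis_restriction_iff_card)
  moreover have "Y \<inter> (S \<inter> T) = Z"
    using Int_eq_of_basis_subset[OF Z Y(2) YI] .
  ultimately show ?thesis
    using card_Int_add_card_Int[OF YI, of S T] card_Int_le_rk[OF YI, of S]
      card_Int_le_rk[OF YI, of T] rk_eq_card[OF Z] rk_eq_card[OF Y(1)]
    by simp
qed

text \<open>Greedy extension through the chain: a later enlargement keeps the rank already attained
  in each earlier \<open>S j\<close>, since the trace there can neither shrink nor exceed
  \<open>rk I (S j)\<close>.\<close>

lemma basis_extension_chain:
  assumes "B \<in> bases (restriction I (S 0))"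
    and "\<And>j. j < n \<Longrightarrow> S j \<subseteq> S (Suc j)"
  shows "\<exists>C. B \<subseteq> C \<and> C \<in> bases (restriction I (S n)) \<and> (\<forall>j\<le>n. card (C \<inter> S j) = rk I (S j))"
  using assms(2)
proof (induction n)
  case 0
  then show ?case
    using assms(1) by (auto simp: basis_restriction_iff_card Int_absorb2)
next
  case (Suc n)
  then obtain C where C: "B \<subseteq> C" "C \<in> bases (restriction I (S n))"
    and card_C: "\<And>j. j \<le> n \<Longrightarrow> card (C \<inter> S j) = rk I (S j)"
    by auto
  have "C \<in> I" "C \<subseteq> S (Suc n)"
    using C(2) Suc.prems[of n] by (auto simp: basis_restriction_iff_card)
  then obtain D where D: "D \<in> bases (restriction I (S (Suc n)))" "C \<subseteq> D"
    using basis_extension by blast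
  then have DI: "D \<in> I"
    by (simp add: basis_restriction_iff_card)
  have "card (D \<inter> S j) = rk I (S j)" if j: "j \<le> Suc n" for j
  proof (cases "j = Suc n")
    case True
    then show ?thesis
      using D(1) by (auto simp: basis_restriction_iff_card Int_absorb2)
  next
    case False
    then have "rk I (S j) \<le> card (D \<inter> S j)"
      using card_C[of j] j D(2) finite_indep[OF DI]
      by (metis Int_mono card_mono finite_Int le_SucE order_refl)
    then show ?thesis
      using card_Int_le_rk[OF DI] by (simp add: le_antisym)
  qed
  with D C(1) show ?case by blast
qed

section \<open>Weights of bases with respect to a filtration\<close>

lemma sum_char_fun:
  assumes F: "filtration E I L F" and B: "B \<in> I"
  shows "(\<Sum>b\<in>B. int (char_fun F b)) = (\<Sum>k<L. int (card B) - int (card (B \<inter> F k)))"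
proof -
  have fin: "finite B"
    using finite_indep[OF B] .
  \<comment> \<open>Layer counting: \<open>b\<close> is missing from \<open>F k\<close> exactly for
    the first \<open>char_fun F b\<close> indices. Swapping the two sums then turns the weight into
    counts per layer.\<close>
  have "int (char_fun F b) = (\<Sum>k<L. if b \<in> F k then 0 else 1)" if "b \<in> B" for b
  proof -
    have bE: "b \<in> E"
      using that indep_subset_ground[OF B] by auto
    then have "char_fun F b \<le> L"
      using filtration_eq_char_fun[OF F, of L] F by (auto simp: filtration_def)
    moreover have "b \<in> F k \<longleftrightarrow> char_fun F b \<le> k" if "k < L" for k
      using filtration_eq_char_fun[OF F, of k] that bE by auto
    ultimately have "{k \<in> {..<L}. b \<notin> F k} = {..<char_fun F b}"
      by auto
    moreover have "(\<Sum>k<L. if b \<in> F k then 0 else (1::int)) = int (card {k \<in> {..<L}. b \<notin> F k})"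
      by (simp add: sum.If_cases Int_def)
    ultimately show ?thesis by simp
  qed
  then have "(\<Sum>b\<in>B. int (char_fun F b)) = (\<Sum>b\<in>B. \<Sum>k<L. if b \<in> F k then 0 else 1)"
    by (intro sum.cong) auto
  also have "\<dots> = (\<Sum>k<L. \<Sum>b\<in>B. if b \<in> F k then 0 else 1)"
    by (rule sum.swap)
  also have "\<dots> = (\<Sum>k<L. int (card B) - int (card (B \<inter> F k)))"
  proof (intro sum.cong refl)
    fix k
    have "B \<inter> - F k = B - B \<inter> F k" by auto
    then have "int (card (B \<inter> - F k)) = int (card B) - int (card (B \<inter> F k))"
      using fin by (simp add: card_Diff_subset card_mono of_nat_diff)
    then show "(\<Sum>b\<in>B. if b \<in> F k then 0 else 1) = int (card B) - int (card (B \<inter> F k))"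
      using fin by (simp add: sum.If_cases Int_def)
  qed
  finally show ?thesis .
qed

text \<open>The weight decreases in each \<open>card (B \<inter> F k)\<close>, which is at most
  \<open>rk I (F k)\<close>. Some basis attains all these bounds at once, so the minimizers are
  exactly the bases that do.\<close>

lemma minimal_weight_basis_char_fun_iff:
  assumes F: "filtration E I L F"
  shows "minimal_weight_basis I (\<lambda>e. int (char_fun F e)) B \<longleftrightarrow>
    B \<in> bases I \<and> (\<forall>k\<le>L. card (B \<inter> F k) = rk I (F k))"
proof (intro iffI conjI allI impI)
  assume min: "minimal_weight_basis I (\<lambda>e. int (char_fun F e)) B"
  show B: "B \<in> bases I"
    using min by (simp add: minimal_weight_basis_def)
  then have BI: "B \<in> I" and cB: "card B = rk I E"
    by (simp_all add: bases_iff_card)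
  have F0: "{} \<in> bases (restriction I (F 0))"
    using F empty_indep by (auto simp: filtration_def bases_def restriction_def)
  \<comment> \<open>The competitor \<open>C\<close> grows from the empty set along the filtration
    and attains every rank; comparing it with \<open>B\<close> bounds the total deficit of
    \<open>B\<close> by zero.\<close>
  obtain C where C: "C \<in> bases (restriction I (F L))"
    and card_C: "\<And>k. k \<le> L \<Longrightarrow> card (C \<inter> F k) = rk I (F k)"
    using basis_extension_chain[of "{}" F L] F F0 by (auto simp: filtration_def)
  have CB: "C \<in> bases I"
    using C F by (simp add: filtration_def restriction_ground)
  then have CI: "C \<in> I" and cC: "card C = rk I E"
    by (simp_all add: bases_iff_card)
  have "(\<Sum>b\<in>B. int (char_fun F b)) \<le> (\<Sum>b\<in>C. int (char_fun F b))"
    using min CB by (simp add: minimal_weight_basis_def)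
  then have le0: "(\<Sum>k<L. int (rk I (F k)) - int (card (B \<inter> F k))) \<le> 0"
    using card_C by (simp add: sum_char_fun[OF F] BI CI cB cC sum_subtractf)
  have nonneg: "0 \<le> int (rk I (F k)) - int (card (B \<inter> F k))" for k
    using card_Int_le_rk[OF BI] by simp
  have zero: "(\<Sum>k<L. int (rk I (F k)) - int (card (B \<inter> F k))) = 0"
    using le0 by (rule order_antisym) (rule sum_nonneg, rule nonneg)
  fix k assume k: "k \<le> L"
  \<comment> \<open>The sum only covers \<open>k < L\<close>; for \<open>k = L\<close> the claim
    holds because \<open>F L = E\<close> and \<open>B\<close> is a basis.\<close>
  show "card (B \<inter> F k) = rk I (F k)"
  proof (cases "k = L")
    case True
    then show ?thesis
      using F cB indep_subset_ground[OF BI] by (simp add: filtration_def Int_absorb2)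
  next
    case False
    then have "k \<in> {..<L}" using k by simp
    then have "int (rk I (F k)) - int (card (B \<inter> F k)) = 0"
      using zero sum_nonneg_eq_0_iff[of "{..<L}" "\<lambda>k. int (rk I (F k)) - int (card (B \<inter> F k))"]
        nonneg by blast
    then show ?thesis by simp
  qed
next
  assume B: "B \<in> bases I \<and> (\<forall>k\<le>L. card (B \<inter> F k) = rk I (F k))"
  have "(\<Sum>b\<in>B. int (char_fun F b)) \<le> (\<Sum>b\<in>B'. int (char_fun F b))" if "B' \<in> bases I" for B'
    unfolding sum_char_fun[OF F conjunct1[OF iffD1[OF bases_iff_card that]]]
      sum_char_fun[OF F conjunct1[OF iffD1[OF bases_iff_card conjunct1[OF B]]]]
    using B that card_Int_le_rk by (intro sum_mono) (auto simp: bases_iff_card)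
  with B show "minimal_weight_basis I (\<lambda>e. int (char_fun F e)) B"
    by (simp add: minimal_weight_basis_def)
qed

section \<open>From modularity to a common basis, and back\<close>

lemma rk_Un_Int_modular:
  assumes "A \<subseteq> B" "rk I (A \<inter> G) + rk I (A \<union> G) = rk I A + rk I G"
  shows "rk I (A \<union> B \<inter> G) + rk I (A \<inter> G) = rk I A + rk I (B \<inter> G)"
proof -
  have "(A \<union> B \<inter> G) \<inter> G = B \<inter> G" "(A \<union> B \<inter> G) \<union> G = A \<union> G" "A \<inter> (B \<inter> G) = A \<inter> G"
    using assms(1) by auto
  \<comment> \<open>Submodularity for \<open>A\<close> and \<open>B \<inter> G\<close> gives one
    inequality. The other comes from submodularity for \<open>A \<union> B \<inter> G\<close> and
    \<open>G\<close>, where the assumed modularity evaluates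
    \<open>rk I (A \<union> G)\<close>.\<close>
  then show ?thesis
    using rk_submodular[of "A \<union> B \<inter> G" G] rk_submodular[of A "B \<inter> G"] assms(2) by simp
qed

text \<open>One step along the first filtration, to be used with \<open>A = F n\<close> and
  \<open>A' = F (Suc n)\<close>.\<close>

lemma basis_extension_modular:
  assumes G: "G 0 = {}" "\<And>j. j < K \<Longrightarrow> G j \<subseteq> G (Suc j)" "A' \<subseteq> G K"
    and A: "A \<subseteq> A'"
    and modular: "\<And>j. j \<le> K \<Longrightarrow> rk I (A \<inter> G j) + rk I (A \<union> G j) = rk I A + rk I (G j)"
    and B: "B \<in> bases (restriction I A)" "\<And>j. j \<le> K \<Longrightarrow> card (B \<inter> G j) = rk I (A \<inter> G j)"
  obtains C where "C \<in> bases (restriction I A')" "C \<inter> A = B"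
    "\<And>j. j \<le> K \<Longrightarrow> card (C \<inter> (A' \<inter> G j)) = rk I (A' \<inter> G j)"
proof -
  \<comment> \<open>This chain starts at \<open>A\<close>, because \<open>G 0\<close> is empty, and
    ends at \<open>A'\<close>.\<close>
  let ?S = "\<lambda>j. A \<union> A' \<inter> G j"
  have SK: "?S K = A'"
    using A G(3) by auto
  have "\<exists>C. B \<subseteq> C \<and> C \<in> bases (restriction I (?S K)) \<and> (\<forall>j\<le>K. card (C \<inter> ?S j) = rk I (?S j))"
    using B(1) G by (intro basis_extension_chain) auto
  then obtain C where C: "B \<subseteq> C" "C \<in> bases (restriction I A')"
    and card_C: "\<And>j. j \<le> K \<Longrightarrow> card (C \<inter> ?S j) = rk I (?S j)"
    unfolding SK by auto
  have CI: "C \<in> I"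
    using C(2) by (simp add: basis_restriction_iff_card)
  have CA: "C \<inter> A = B"
    using Int_eq_of_basis_subset[OF B(1) C(1) CI] .
  have "card (C \<inter> (A' \<inter> G j)) = rk I (A' \<inter> G j)" if j: "j \<le> K" for j
  proof -
    have "C \<inter> (A \<inter> (A' \<inter> G j)) = B \<inter> G j"
      using CA A by auto
    \<comment> \<open>\<open>C\<close> attains the rank of \<open>?S j\<close>, and \<open>B\<close>
      that of \<open>A \<inter> G j\<close>. By \<open>rk_Un_Int_modular\<close> the right side
      equals \<open>rk I A + rk I (A' \<inter> G j)\<close>, and \<open>card (C \<inter> A)\<close>
      is \<open>rk I A\<close>.\<close>
    then have "card (C \<inter> A) + card (C \<inter> (A' \<inter> G j)) = rk I (?S j) + rk I (A \<inter> G j)"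
      using card_Int_add_card_Int[OF CI, of A "A' \<inter> G j"] card_C[OF j] B(2)[OF j] by simp
    then show ?thesis
      using rk_Un_Int_modular[OF A modular[OF j]] rk_eq_card[OF B(1)] CA by simp
  qed
  then show thesis
    using that C(2) CA by blast
qed

lemma modular_pair_imp_common_basis:
  assumes F: "filtration E I L F" and G: "filtration E I K G"
    and modular: "modular_pair I L F K G"
  obtains B where "B \<in> bases I"
    "\<And>i j. i \<le> L \<Longrightarrow> j \<le> K \<Longrightarrow> card (B \<inter> (F i \<inter> G j)) = rk I (F i \<inter> G j)"
proof -
  have "\<exists>B\<in>bases (restriction I (F n)). \<forall>i\<le>n. \<forall>j\<le>K. card (B \<inter> (F i \<inter> G j)) = rk I (F i \<inter> G j)"
    if "n \<le> L" for n
    using that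
  proof (induction n)
    case 0
    have "F 0 = {}"
      using F by (simp add: filtration_def)
    moreover have empty: "{} \<in> bases (restriction I {})"
      using empty_indep by (auto simp: bases_def restriction_def)
    ultimately show ?case
      using rk_eq_card[OF empty] by auto
  next
    case (Suc n)
    then obtain B where B: "B \<in> bases (restriction I (F n))"
      and card_B: "\<And>i j. i \<le> n \<Longrightarrow> j \<le> K \<Longrightarrow> card (B \<inter> (F i \<inter> G j)) = rk I (F i \<inter> G j)"
      by auto
    have FE: "F (Suc n) \<subseteq> G K"
      using F G Suc.prems by (simp add: filtration_def flat_def)
    have F_mono: "F i \<subseteq> F n" if "i \<le> n" for i
      using filtration_eq_char_fun[OF F, of i] filtration_eq_char_fun[OF F, of n] that Suc.prems
      by auto
    have "B \<inter> (F n \<inter> G j) = B \<inter> G j" for j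
      using B by (auto simp: basis_restriction_iff_card)
    then have "card (B \<inter> G j) = rk I (F n \<inter> G j)" if "j \<le> K" for j
      using card_B[of n j] that by simp
    then obtain C where C: "C \<in> bases (restriction I (F (Suc n)))" "C \<inter> F n = B"
      and card_C: "\<And>j. j \<le> K \<Longrightarrow> card (C \<inter> (F (Suc n) \<inter> G j)) = rk I (F (Suc n) \<inter> G j)"
      using basis_extension_modular[of G K "F (Suc n)" "F n" B] B F G FE modular Suc.prems
      by (auto simp: filtration_def modular_pair_def)
    have "card (C \<inter> (F i \<inter> G j)) = rk I (F i \<inter> G j)" if "i \<le> Suc n" "j \<le> K" for i j
    proof (cases "i = Suc n")
      case False
      with that have "i \<le> n" by simp
      moreover from this have "C \<inter> (F i \<inter> G j) = B \<inter> (F i \<inter> G j)"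
        \<comment> \<open>The new elements of \<open>C\<close> lie outside \<open>F n\<close>, so
          the counts for earlier indices are unchanged.\<close>
        using C(2) F_mono by auto
      ultimately show ?thesis
        using card_B that by simp
    qed (use card_C that in simp)
    with C(1) show ?case by blast
  qed
  from this[of L] show thesis
    using F that by (auto simp: filtration_def restriction_ground)
qed

text \<open>Counting \<open>B\<close> in \<open>F i\<close> and \<open>G j\<close> gives the sum of
  their ranks; the same count, taken in the intersection and the union, is at most the sum of the
  ranks there.\<close>

lemma common_basis_imp_modular_pair:
  assumes "B \<in> I"
    and "\<And>i. i \<le> L \<Longrightarrow> card (B \<inter> F i) = rk I (F i)"
    and "\<And>j. j \<le> K \<Longrightarrow> card (B \<inter> G j) = rk I (G j)"
  shows "modular_pair I L F K G"
  unfolding modular_pair_def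
proof (intro allI impI order_antisym)
  fix i j assume "i \<le> L" "j \<le> K"
  then show "rk I (F i) + rk I (G j) \<le> rk I (F i \<inter> G j) + rk I (F i \<union> G j)"
    using card_Int_add_card_Int[OF assms(1), of "F i" "G j"]
      card_Int_le_rk[OF assms(1), of "F i \<inter> G j"] card_Int_le_rk[OF assms(1), of "F i \<union> G j"]
      assms(2,3)[symmetric] by simp
qed (rule rk_submodular)

end

theorem proposition5:
  fixes E :: "'a set" and I :: "'a set set"
    and F G :: "nat \<Rightarrow> 'a set" and L K :: nat
  assumes "finite_rank_matroid E I"
    and "filtration E I L F"
    and "filtration E I K G"
  shows "(modular_pair I L F K G \<longleftrightarrow>
            (\<exists>B. minimal_weight_basis I (\<lambda>e. int (char_fun F e)) B
               \<and> minimal_weight_basis I (\<lambda>e. int (char_fun G e)) B))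
       \<and> (modular_pair I L F K G \<longleftrightarrow>
            (\<exists>B\<in>bases I. \<forall>i\<le>L. \<forall>j\<le>K.
               B \<inter> (F i \<inter> G j) \<in> bases (restriction I (F i \<inter> G j))))"
proof -
  interpret finite_rank_matroid E I by fact
  note F = assms(2) and G = assms(3)
  let ?mod = "modular_pair I L F K G"
  let ?min = "\<exists>B. minimal_weight_basis I (\<lambda>e. int (char_fun F e)) B
               \<and> minimal_weight_basis I (\<lambda>e. int (char_fun G e)) B"
  let ?bas = "\<exists>B\<in>bases I. \<forall>i\<le>L. \<forall>j\<le>K.
               B \<inter> (F i \<inter> G j) \<in> bases (restriction I (F i \<inter> G j))"
  \<comment> \<open>The implications are closed in a cycle: \<open>?mod\<close> to
    \<open>?bas\<close> to \<open>?min\<close> to \<open>?mod\<close>.\<close>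
  have "?bas" if mod: ?mod
  proof -
    obtain B where B: "B \<in> bases I"
      "\<And>i j. i \<le> L \<Longrightarrow> j \<le> K \<Longrightarrow> card (B \<inter> (F i \<inter> G j)) = rk I (F i \<inter> G j)"
      using modular_pair_imp_common_basis[OF F G mod] by blast
    then show ?thesis
      using Int_basis_iff_card by (intro bexI[of _ B]) (auto simp: bases_iff_card)
  qed
  moreover have "?min" if bas: ?bas
  proof -
    obtain B where B: "B \<in> bases I"
      and basis: "\<And>i j. i \<le> L \<Longrightarrow> j \<le> K \<Longrightarrow> B \<inter> (F i \<inter> G j) \<in> bases (restriction I (F i \<inter> G j))"
      using bas by blast
    \<comment> \<open>Since \<open>G K\<close> and \<open>F L\<close> both equal \<open>E\<close>,
      the cases \<open>j = K\<close> and \<open>i = L\<close> recover the members of each single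
      filtration.\<close>
    have "F i \<inter> G K = F i" if "i \<le> L" for i
      using F G that by (auto simp: filtration_def flat_def)
    then have "card (B \<inter> F i) = rk I (F i)" if "i \<le> L" for i
      using rk_eq_card[OF basis[of i K]] that by simp
    moreover have "F L \<inter> G j = G j" if "j \<le> K" for j
      using F G that by (auto simp: filtration_def flat_def)
    then have "card (B \<inter> G j) = rk I (G j)" if "j \<le> K" for j
      using rk_eq_card[OF basis[of L j]] that by simp
    ultimately show ?thesis
      using B by (auto simp: minimal_weight_basis_char_fun_iff[OF F]
          minimal_weight_basis_char_fun_iff[OF G])
  qed
  moreover have "?mod" if ?min
    using that common_basis_imp_modular_pair
    by (auto simp: minimal_weight_basis_char_fun_iff[OF F]
        minimal_weight_basis_char_fun_iff[OF G] bases_iff_card)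
  ultimately show ?thesis by blast
qed

end
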